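(* Let $X=[n]$ be the disjoint union of sets $X_1,\dots,X_r$, with $|X_k|=n_k$ for $k\in[r]$. Let $A_1,\dots,A_m,B_1,\dots,B_m\subseteq X$ be such that $\mathcal{P}=\{(A_i,B_i)\mid i\in[m]\}$ is a skew Bollobás system. Then $$\sum_{i=1}^m \left(\prod_{k=1}^r \binom{|A_i\cap X_k|+|B_i\cap X_k|}{|A_i\cap X_k|}\right)^{-1} \le \prod_{k=1}^r (1+n_k) \le \left(1+\frac{n}{r}\right)^r.$$
   Context: A family of pairs of sets $\mathcal{P}=\{(A_i,B_i)\mid i\in[m]\}$ is called a skew Bollobás system if (1) $A_i\cap B_i=\emptyset$ for every $i\in[m]$, and (2) $A_i\cap B_j\neq\emptyset$ whenever $i<j$. Here $[n]=\{1,\dots,n\}$. *)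

theory Defs
  imports Complex_Main "HOL-Library.Disjoint_Sets"
begin

definition skew_bollobas_system :: "nat \<Rightarrow> (nat \<Rightarrow> 'a set) \<Rightarrow> (nat \<Rightarrow> 'a set) \<Rightarrow> bool" where
  "skew_bollobas_system m A B \<longleftrightarrow>
     (\<forall>i\<in>{1..m}. A i \<inter> B i = {}) \<and>
     (\<forall>i\<in>{1..m}. \<forall>j\<in>{1..m}. i < j \<longrightarrow> A i \<inter> B j \<noteq> {})"

end

theory Submission
  imports Defs "HOL-Combinatorics.Multiset_Permutations" "HOL-Library.FuncSet"
begin

text \<open>
  Choose independent uniformly random linear orders of the parts \<open>X\<^sub>1, \<dots>, X\<^sub>r\<close>.
  The summand belonging to \<open>i\<close> is the probability that in every part \<open>X\<^sub>k\<close> all of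
  \<open>A\<^sub>i \<inter> X\<^sub>k\<close> comes before all of \<open>B\<^sub>i \<inter> X\<^sub>k\<close>, i.e. that some initial segment of
  length \<open>t\<^sub>i\<^sub>k \<in> {0, \<dots>, n\<^sub>k}\<close> separates them. Fix the orders. If \<open>i < j\<close> are both
  separated, then an element of \<open>A\<^sub>i \<inter> B\<^sub>j\<close> in \<open>X\<^sub>k\<close> forces \<open>t\<^sub>i\<^sub>k > t\<^sub>j\<^sub>k\<close>, so the
  vectors \<open>(t\<^sub>i\<^sub>k)\<^sub>k\<close> are distinct and there are at most \<open>\<Prod>\<^sub>k (1 + n\<^sub>k)\<close> of them.
  Averaging over the orders gives the first inequality; the second is AM-GM.
\<close>

text \<open>The cut position \<open>t\<close> is kept explicit because it later becomes one
  coordinate of a vector. It ranges over \<open>length xs + 1\<close> values, both ends included,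
  which is where the factor \<open>1 + n_k\<close> comes from.\<close>

definition separated :: "'a set \<Rightarrow> 'a set \<Rightarrow> 'a list \<Rightarrow> bool" where
  "separated A B xs \<longleftrightarrow> (\<exists>t\<le>length xs. A \<subseteq> set (take t xs) \<and> B \<inter> set (take t xs) = {})"

lemma separated_empty_left: "separated {} B xs"
  unfolding separated_def by (rule exI[of _ 0]) simp

lemma separated_empty_right: "A \<subseteq> set xs \<Longrightarrow> separated A {} xs"
  unfolding separated_def by (rule exI[of _ "length xs"]) simp

text \<open>Moving the cut one place to the right puts \<open>x\<close> into the initial segment,
  which is harmless since \<open>x\<close> is not in \<open>B\<close>. Writing
  \<open>A - {x}\<close> covers both \<open>x\<close> in \<open>A\<close> and \<open>x\<close>
  outside \<open>A\<close>.\<close>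

lemma separated_Cons:
  assumes "separated (A - {x}) B xs" "x \<notin> B"
  shows "separated A B (x # xs)"
proof -
  obtain t where "t \<le> length xs" "A - {x} \<subseteq> set (take t xs)" "B \<inter> set (take t xs) = {}"
    using assms(1) unfolding separated_def by blast
  then show ?thesis
    unfolding separated_def using assms(2) by (intro exI[of _ "Suc t"]) auto
qed

definition separating_orders :: "'a set \<Rightarrow> 'a set \<Rightarrow> 'a set \<Rightarrow> 'a list set" where
  "separating_orders S A B = {xs \<in> permutations_of_set S. separated A B xs}"

lemma finite_separating_orders [simp]: "finite (separating_orders S A B)"
  unfolding separating_orders_def by simp

text \<open>Condition on the first element of the order, which must not lie in \<open>B\<close>.\<close>

lemma card_separating_orders_step:
  assumes "finite S" "A \<subseteq> S"
  shows "(\<Sum>x\<in>S - B. card (separating_orders (S - {x}) (A - {x}) B))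
           \<le> card (separating_orders S A B)"
proof -
  let ?T = "\<lambda>x. (#) x ` separating_orders (S - {x}) (A - {x}) B"
  have "(\<Sum>x\<in>S - B. card (separating_orders (S - {x}) (A - {x}) B)) = (\<Sum>x\<in>S - B. card (?T x))"
    by (intro sum.cong refl) (simp add: card_image)
  also have "\<dots> = card (\<Union>x\<in>S - B. ?T x)"
    using assms by (intro card_UN_disjoint[symmetric]) auto
  also have "\<dots> \<le> card (separating_orders S A B)"
  proof (rule card_mono)
    show "(\<Union>x\<in>S - B. ?T x) \<subseteq> separating_orders S A B"
    proof clarify
      fix x xs assume "x \<in> S" "x \<notin> B" "xs \<in> separating_orders (S - {x}) (A - {x}) B"
      then show "x # xs \<in> separating_orders S A B"
        unfolding separating_orders_def using separated_Cons[of A x B xs]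
        by (auto simp: permutations_of_set_def)
    qed
  qed simp
  finally show ?thesis .
qed

text \<open>This is the probability bound with denominators cleared, so that the induction stays in
  the naturals. A first element from \<open>A\<close> leaves the pair \<open>A - {x}\<close>,
  \<open>B\<close>; one outside both sets leaves the pair unchanged; the induction hypothesis
  applies to \<open>S - {x}\<close> in either case.\<close>

lemma fact_le_card_separating_orders:
  assumes "finite S" "A \<subseteq> S" "B \<subseteq> S" "A \<inter> B = {}"
  shows "fact (card S) * fact (card A) * fact (card B)
           \<le> fact (card A + card B) * card (separating_orders S A B)"
  using assms
proof (induction "card S" arbitrary: S A B rule: less_induct)
  case less
  note fin = \<open>finite S\<close> finite_subset[OF \<open>A \<subseteq> S\<close> \<open>finite S\<close>] finite_subset[OF \<open>B \<subseteq> S\<close> \<open>finite S\<close>]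
  show ?case
  \<comment> \<open>If one of the sets is empty, a cut at an end of the list works, so every order
    separates.\<close>
  proof (cases "A = {} \<or> B = {}")
    case True
    then have "separating_orders S A B = permutations_of_set S"
      using less.prems unfolding separating_orders_def
      by (auto intro: separated_empty_left separated_empty_right dest: permutations_of_setD)
    then show ?thesis
      using True fin by auto
  next
    case False
    let ?F = "\<lambda>x. card (separating_orders (S - {x}) (A - {x}) B)"
    obtain a where a: "card A = Suc a"
      using False fin by (metis card_eq_0_iff not0_implies_Suc)
    obtain N where N: "card S = Suc N"
      using False fin less.prems by (metis card_eq_0_iff not0_implies_Suc subset_empty)
    define b where "b = card B"
    define c where "c = card (S - (A \<union> B))"
    have "card (A \<union> B) = Suc a + b"
      using less.prems fin a by (simp add: card_Un_disjoint b_def)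
    moreover have "card S = card (A \<union> B) + card (S - (A \<union> B))"
      using less.prems fin
      by (metis Un_least card_Diff_subset card_mono finite_UnI le_add_diff_inverse)
    ultimately have Nabc: "Suc N = Suc a + b + c"
      using N by (simp add: c_def)
    have in_A: "fact N * fact a * fact b \<le> fact (a + b) * ?F x" if "x \<in> A" for x
    proof -
      have "x \<in> S" using that less.prems by auto
      then have "card (S - {x}) = N" "card (A - {x}) = a"
        using that fin a N by simp_all
      then show ?thesis
        using less.hyps[of "S - {x}" "A - {x}" B] less.prems that N by (auto simp: b_def)
    qed
    have outside: "fact N * fact (Suc a) * fact b \<le> fact (Suc a + b) * ?F x"
      if "x \<in> S - (A \<union> B)" for x
    proof -
      have "card (S - {x}) = N" "A - {x} = A"
        using that fin N by simp_all
      then show ?thesis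
        using less.hyps[of "S - {x}" A B] less.prems that N a by (auto simp: b_def)
    qed
    \<comment> \<open>The leading factor \<open>Suc N\<close> is split as
      \<open>(Suc a + b) + c\<close>. In the first term, the \<open>Suc a\<close> taken out of
      \<open>fact (Suc a)\<close> counts the first elements in \<open>A\<close>, and
      \<open>Suc a + b\<close> lifts \<open>fact (a + b)\<close> from \<open>in_A\<close> to
      \<open>fact (Suc a + b)\<close>. In the second, \<open>c\<close> counts the first elements
      outside both sets.\<close>
    have "fact (Suc N) * fact (Suc a) * fact b
        = Suc a * ((Suc a + b) * (fact N * fact a * fact b)) + c * (fact N * fact (Suc a) * fact b)"
      unfolding fact_Suc[of N] by (simp add: Nabc fact_Suc[of a] algebra_simps del: fact_Suc)
    also have "\<dots> = (\<Sum>x\<in>A. (Suc a + b) * (fact N * fact a * fact b))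
        + (\<Sum>x\<in>S - (A \<union> B). fact N * fact (Suc a) * fact b)"
      by (simp only: sum_constant a c_def of_nat_id)
    also have "\<dots> \<le> (\<Sum>x\<in>A. (Suc a + b) * (fact (a + b) * ?F x))
        + (\<Sum>x\<in>S - (A \<union> B). fact (Suc a + b) * ?F x)"
      by (intro add_mono sum_mono mult_le_mono order_refl in_A outside)
    also have "\<dots> = fact (Suc a + b) * ((\<Sum>x\<in>A. ?F x) + (\<Sum>x\<in>S - (A \<union> B). ?F x))"
      by (simp only: sum_distrib_left distrib_left fact_Suc add_Suc of_nat_id mult.assoc)
    also have "(\<Sum>x\<in>A. ?F x) + (\<Sum>x\<in>S - (A \<union> B). ?F x) = (\<Sum>x\<in>A \<union> (S - (A \<union> B)). ?F x)"
      using fin by (intro sum.union_disjoint[symmetric]) auto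
    also have "A \<union> (S - (A \<union> B)) = S - B"
      using less.prems by auto
    also have "fact (Suc a + b) * (\<Sum>x\<in>S - B. ?F x)
        \<le> fact (Suc a + b) * card (separating_orders S A B)"
      by (intro mult_le_mono order_refl card_separating_orders_step less.prems)
    finally show ?thesis
      by (simp only: N a b_def)
  qed
qed

text \<open>Cancelling \<open>fact (card A) * fact (card B)\<close> in the previous bound leaves the
  binomial coefficient: a uniformly random order of \<open>S\<close> separates with probability at
  least its inverse.\<close>

lemma fact_div_binomial_le_card_separating_orders:
  assumes "finite S" "A \<subseteq> S" "B \<subseteq> S" "A \<inter> B = {}"
  shows "fact (card S) * inverse (real ((card A + card B) choose card A))
           \<le> real (card (separating_orders S A B))"
proof -
  let ?C = "(card A + card B) choose card A" and ?F = "card (separating_orders S A B)"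
  let ?ab = "fact (card A) * fact (card B) :: nat"
  have C: "fact (card A + card B) = ?ab * ?C"
    using binomial_fact_lemma[of "card A" "card A + card B"] by simp
  have "?ab * fact (card S) \<le> ?ab * (?C * ?F)"
    using fact_le_card_separating_orders[OF assms] unfolding C by (simp add: ac_simps)
  then have "fact (card S) \<le> ?C * ?F"
    by (simp only: mult_le_cancel1) simp
  then have "real (fact (card S)) \<le> real ?C * real ?F"
    using of_nat_mono[where ?'a = real] by (metis of_nat_mult)
  moreover have "?C > 0" by simp
  ultimately show ?thesis
    by (simp add: field_simps)
qed

lemma card_separated_indices_le:
  fixes X :: "'k \<Rightarrow> 'a set"
  assumes "finite K" and skew: "skew_bollobas_system m A B"
    and A_sub: "\<And>i. i \<in> {1..m} \<Longrightarrow> A i \<subseteq> (\<Union>k\<in>K. X k)"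
    and orders: "\<And>k. k \<in> K \<Longrightarrow> \<omega> k \<in> permutations_of_set (X k)"
  shows "card {i\<in>{1..m}. \<forall>k\<in>K. separated (A i \<inter> X k) (B i \<inter> X k) (\<omega> k)}
           \<le> (\<Prod>k\<in>K. Suc (card (X k)))" (is "card ?I \<le> _")
proof -
  let ?P = "\<lambda>i k t. t \<le> card (X k) \<and> A i \<inter> X k \<subseteq> set (take t (\<omega> k)) \<and>
      B i \<inter> X k \<inter> set (take t (\<omega> k)) = {}"
  define t where "t i k = (SOME t. ?P i k t)" for i k
  have t: "?P i k (t i k)" if "i \<in> ?I" "k \<in> K" for i k
  proof -
    have "length (\<omega> k) = card (X k)"
      using orders[OF \<open>k \<in> K\<close>] by (rule length_finite_permutations_of_set)
    moreover have "separated (A i \<inter> X k) (B i \<inter> X k) (\<omega> k)"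
      using that by blast
    ultimately have "\<exists>t. ?P i k t"
      unfolding separated_def by simp
    then show ?thesis
      unfolding t_def by (rule someI_ex)
  qed
  \<comment> \<open>Restriction to \<open>K\<close> makes the cut vectors extensional, so that they
    are members of a finite \<open>PiE\<close>.\<close>
  let ?\<tau> = "\<lambda>i. restrict (t i) K"
  have neq: "?\<tau> i \<noteq> ?\<tau> j" if ij: "i \<in> ?I" "j \<in> ?I" "i < j" for i j
  proof
    assume eq: "?\<tau> i = ?\<tau> j"
    obtain x where x: "x \<in> A i" "x \<in> B j"
      using skew ij unfolding skew_bollobas_system_def by blast
    then obtain k where k: "k \<in> K" "x \<in> X k"
      using A_sub[of i] ij by auto
    have "t i k = t j k"
      using fun_cong[OF eq, of k] k by simp
    \<comment> \<open>Equal cuts give the same initial segment of \<open>\<omega> k\<close>; it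
      contains \<open>x\<close> because \<open>x\<close> is in \<open>A i\<close>, and misses
      \<open>x\<close> because \<open>x\<close> is in \<open>B j\<close>.\<close>
    then show False
      using t[OF ij(1) k(1)] t[OF ij(2) k(1)] x k by auto
  qed
  have "inj_on ?\<tau> ?I"
  proof (rule inj_onI)
    fix i j assume "i \<in> ?I" "j \<in> ?I" "?\<tau> i = ?\<tau> j"
    then show "i = j"
      using neq[of i j] neq[of j i] by (cases i j rule: linorder_cases) simp_all
  qed
  moreover have "?\<tau> ` ?I \<subseteq> PiE K (\<lambda>k. {0..card (X k)})"
  proof (intro image_subsetI restrict_PiE_iff[THEN iffD2] ballI)
    fix i k assume "i \<in> ?I" "k \<in> K"
    then have "t i k \<le> card (X k)"
      using t by blast
    then show "t i k \<in> {0..card (X k)}"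
      by simp
  qed
  ultimately have "card ?I \<le> card (PiE K (\<lambda>k. {0..card (X k)}))"
    using \<open>finite K\<close> by (intro card_inj_on_le[of ?\<tau>] finite_PiE) auto
  then show ?thesis
    using \<open>finite K\<close> by (simp add: card_PiE)
qed

theorem skew_bollobas_partition:
  fixes X :: "'k \<Rightarrow> 'a set"
  assumes K: "finite K" and X: "\<And>k. k \<in> K \<Longrightarrow> finite (X k)"
    and A_sub: "\<And>i. i \<in> {1..m} \<Longrightarrow> A i \<subseteq> (\<Union>k\<in>K. X k)"
    and skew: "skew_bollobas_system m A B"
  shows "(\<Sum>i=1..m. inverse (\<Prod>k\<in>K.
            real ((card (A i \<inter> X k) + card (B i \<inter> X k)) choose card (A i \<inter> X k))))
          \<le> (\<Prod>k\<in>K. 1 + real (card (X k)))"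
proof -
  let ?b = "\<lambda>i k. real ((card (A i \<inter> X k) + card (B i \<inter> X k)) choose card (A i \<inter> X k))"
  let ?\<Omega> = "PiE K (\<lambda>k. permutations_of_set (X k))"
  let ?sep = "\<lambda>\<omega> i. \<forall>k\<in>K. separated (A i \<inter> X k) (B i \<inter> X k) (\<omega> k)"
  \<comment> \<open>\<open>F\<close> is the number of tuples of orders; multiplying by it turns
    probabilities into counts.\<close>
  define F :: real where "F = (\<Prod>k\<in>K. fact (card (X k)))"
  have "F > 0"
    unfolding F_def by (intro prod_pos) simp
  have fin: "finite ?\<Omega>"
    using K by (intro finite_PiE) auto
  have card_\<Omega>: "real (card ?\<Omega>) = F"
    using K X by (simp add: card_PiE F_def)
  have prob: "F * inverse (\<Prod>k\<in>K. ?b i k) \<le> real (card {\<omega>\<in>?\<Omega>. ?sep \<omega> i})"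
    if i: "i \<in> {1..m}" for i
  proof -
    \<comment> \<open>Independence of the orders: the tuples that separate index \<open>i\<close>
      everywhere form a product set, so the bound for a single part applies factor by
      factor.\<close>
    have "F * inverse (\<Prod>k\<in>K. ?b i k) = (\<Prod>k\<in>K. fact (card (X k)) * inverse (?b i k))"
      unfolding F_def prod.distrib prod_inversef[symmetric] by (simp add: o_def)
    also have "\<dots> \<le> (\<Prod>k\<in>K. real (card (separating_orders (X k) (A i \<inter> X k) (B i \<inter> X k))))"
      using skew i X unfolding skew_bollobas_system_def
      by (intro prod_mono conjI fact_div_binomial_le_card_separating_orders) auto
    also have "\<dots> = real (card (PiE K (\<lambda>k. separating_orders (X k) (A i \<inter> X k) (B i \<inter> X k))))"
      using K by (simp add: card_PiE)
    also have "PiE K (\<lambda>k. separating_orders (X k) (A i \<inter> X k) (B i \<inter> X k)) = {\<omega>\<in>?\<Omega>. ?sep \<omega> i}"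
      by (auto simp: separating_orders_def PiE_def Pi_iff)
    finally show ?thesis .
  qed
  have "F * (\<Sum>i=1..m. inverse (\<Prod>k\<in>K. ?b i k)) \<le> (\<Sum>i=1..m. real (card {\<omega>\<in>?\<Omega>. ?sep \<omega> i}))"
    unfolding sum_distrib_left by (intro sum_mono prob)
  also have "\<dots> = real (\<Sum>i=1..m. card {\<omega>\<in>?\<Omega>. ?sep \<omega> i})"
    by simp
  \<comment> \<open>Double counting of the pairs of an index and a tuple of orders separating
    it.\<close>
  also have "(\<Sum>i=1..m. card {\<omega>\<in>?\<Omega>. ?sep \<omega> i}) = (\<Sum>\<omega>\<in>?\<Omega>. card {i\<in>{1..m}. ?sep \<omega> i})"
    using fin by (intro sum_multicount_gen) auto
  also have "\<dots> \<le> (\<Sum>\<omega>\<in>?\<Omega>. \<Prod>k\<in>K. Suc (card (X k)))"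
    using K skew A_sub by (intro sum_mono card_separated_indices_le) (auto simp: PiE_iff)
  finally have "F * (\<Sum>i=1..m. inverse (\<Prod>k\<in>K. ?b i k)) \<le> F * (\<Prod>k\<in>K. 1 + real (card (X k)))"
    by (simp add: card_\<Omega>)
  then show ?thesis
    using \<open>F > 0\<close> by simp
qed

text \<open>AM-GM from \<open>y \<le> exp (y - 1)\<close> with \<open>y = f k / M\<close>, where
  \<open>M\<close> is the mean: in the product over \<open>K\<close> the exponents add up to 0, so
  the right-hand side is 1.\<close>

lemma prod_le_arith_mean_power:
  fixes f :: "'a \<Rightarrow> real"
  assumes "finite K" "K \<noteq> {}" and pos: "\<And>k. k \<in> K \<Longrightarrow> 0 < f k"
  shows "prod f K \<le> (sum f K / card K) ^ card K"
proof -
  define M where "M = sum f K / card K"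
  have M: "M > 0"
    unfolding M_def using assms by (intro divide_pos_pos sum_pos) (auto simp: card_gt_0_iff)
  have "(\<Prod>k\<in>K. f k / M) \<le> (\<Prod>k\<in>K. exp (f k / M - 1))"
  proof (intro prod_mono conjI)
    fix k assume "k \<in> K"
    then show "0 \<le> f k / M" using pos[of k] M by simp
    show "f k / M \<le> exp (f k / M - 1)" using exp_ge_add_one_self[of "f k / M - 1"] by simp
  qed
  also have "\<dots> = exp (sum f K / M - card K)"
    using assms by (simp add: exp_sum[symmetric] sum_subtractf sum_divide_distrib)
  also have "sum f K / M = card K"
    using M assms unfolding M_def by (auto simp: field_simps)
  finally have "prod f K / M ^ card K \<le> 1"
    by (simp add: prod_dividef)
  then show ?thesis
    using M by (simp add: M_def[symmetric] field_simps)
qed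

theorem theorem1p7:
  fixes n r m :: nat
    and X :: "nat \<Rightarrow> nat set"
    and N :: "nat \<Rightarrow> nat"
    and A B :: "nat \<Rightarrow> nat set"
  assumes r: "1 \<le> r"
    and union: "(\<Union>k\<in>{1..r}. X k) = {1..n}"
    and disjoint: "disjoint_family_on X {1..r}"
    and card_X: "\<And>k. k \<in> {1..r} \<Longrightarrow> card (X k) = N k"
    and A_sub: "\<And>i. i \<in> {1..m} \<Longrightarrow> A i \<subseteq> {1..n}"
    and B_sub: "\<And>i. i \<in> {1..m} \<Longrightarrow> B i \<subseteq> {1..n}"
    and skew: "skew_bollobas_system m A B"
  shows "(\<Sum>i=1..m. inverse (\<Prod>k=1..r.
            real ((card (A i \<inter> X k) + card (B i \<inter> X k)) choose card (A i \<inter> X k))))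
          \<le> (\<Prod>k=1..r. 1 + real (N k))
       \<and> (\<Prod>k=1..r. 1 + real (N k)) \<le> (1 + real n / real r) ^ r"
proof
  have fin: "finite (X k)" if "k \<in> {1..r}" for k
    using union that by (metis UN_upper finite_atLeastAtMost finite_subset)
  have "(\<Sum>k\<in>{1..r}. N k) = card (\<Union>k\<in>{1..r}. X k)"
    using disjoint fin card_X
    by (subst card_UN_disjoint) (auto simp: disjoint_family_on_def)
  then have sum_N: "(\<Sum>k=1..r. real (N k)) = real n"
    unfolding union by (metis card_atLeastAtMost diff_Suc_1 of_nat_sum)
  show "(\<Sum>i=1..m. inverse (\<Prod>k=1..r.
            real ((card (A i \<inter> X k) + card (B i \<inter> X k)) choose card (A i \<inter> X k))))
          \<le> (\<Prod>k=1..r. 1 + real (N k))"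
    using skew_bollobas_partition[of "{1..r}" X m A B] fin A_sub union skew card_X by simp
  \<comment> \<open>AM-GM for the numbers \<open>1 + N k\<close>, whose sum is \<open>r + n\<close>
    by \<open>sum_N\<close>.\<close>
  have "(\<Prod>k=1..r. 1 + real (N k)) \<le> ((\<Sum>k=1..r. 1 + real (N k)) / card {1..r}) ^ card {1..r}"
    using r by (intro prod_le_arith_mean_power) auto
  also have "(\<Sum>k=1..r. 1 + real (N k)) / card {1..r} = 1 + real n / real r"
    using r by (simp add: sum.distrib sum_N[simplified] add_divide_distrib)
  finally show "(\<Prod>k=1..r. 1 + real (N k)) \<le> (1 + real n / real r) ^ r"
    by simp
qed

end
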